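(* Consider the polling model described in the context and suppose that the Markov chain $\mathcal L$ is ergodic. Let $F=(F_1,\ldots,F_N)$ and $\widetilde F=(\widetilde F_1,\ldots,\widetilde F_N)$, where $F_i=\mathbb P(S=i)$ and $\widetilde F_i=\mathbb P(S=i,X_i=0)$ under the stationary distribution, and let $\mathcal A=(\alpha_{i;q})_{i,q\in\mathcal S}$, $\widetilde{\mathcal A}=(\tilde\alpha_{i;q})_{i,q\in\mathcal S}$. Then, with ${}^*F$ denoting the transpose of $F$ and $\vec e=(1,\ldots,1)$, $$ {}^*F\,\vec e=1,\qquad {}^*F[I-P]={}^*\widetilde F[\widetilde P-P],\qquad {}^*F[I-\mathcal A]={}^*\widetilde F[I-\mathcal A+\widetilde{\mathcal A}].$$ Let $\hat\rho=\sum_{i=1}^N\lambda_i(\tau_i-\tilde\tau_i)$. If $\hat\rho\ne1$, the last two equations can be rewritten equivalently as $$F_j=\sum_{i\in\mathcal S}\tilde p_{i,j}F_i+\bar\tau\sum_{i\in\mathcal S}\lambda_i(p_{i,j}-\tilde p_{i,j})\quad\text{for all }j\in\mathcal S,\qquad \bar\tau=\frac1{1-\hat\rho}\sum_{j\in\mathcal S}F_j\tilde\tau_j,$$ together with $$\widetilde F_j=F_j-\lambda_j\bar\tau\quad\text{for all }j\in\mathcal S .$$ Moreover, the mean time between two consecutive visits of the server to queue $j$ is $$\mathbb E\,T_{j,j}=\frac{\bar\tau}{F_j}.$$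
   Context: Polling model. Let $\mathcal S=\{1,\ldots,N\}$ be the set of stations and let $P=(p_{i,j})_{i,j\in\mathcal S}$ and $\widetilde P=(\tilde p_{i,j})_{i,j\in\mathcal S}$ be stochastic matrices. For each $i,j$, $(B_{i,j}(n))_n$ and $(\widetilde B_{i,j}(n))_n$ are sequences of random vectors in $\mathbb Z_+^N$ with finite means, i.i.d. in $n$; the components $B_{i,j;q}(n)$, $q\in\mathcal S$, of each vector may be dependent and have different laws. The process $\mathcal L=(S(n),X(n))_{n\ge 0}$, with $S(n)\in\mathcal S$ (position of the server at polling instant $n$) and $X(n)\in\mathbb Z_+^N$ (queue lengths at polling instant $n$), is the Markov chain on $\mathcal S\times\mathbb Z_+^N$ with the following dynamics. Given the past up to $n$ with $S(n)=i$: - if $X_i(n)>0$, then $S(n+1)=j$ with probability $p_{i,j}$, and in that case $X(n+1)=X(n)-\vec e_i+B_{i,j}(n)$; - if $X_i(n)=0$, then $S(n+1)=j$ with probability $\tilde p_{i,j}$, and in that case $X(n+1)=X(n)+\widetilde B_{i,j}(n)$. Here $\vec e_i$ is the $i$-th canonical basis vector, and the routing choices and the vectors $B_{i,j}(n),\widetilde B_{i,j}(n)$ are independent of each other and of the past up to $n$. The chain $\mathcal L$ is assumed irreducible. $(S,X)$ denotes a pair with the stationary distribution. Mean values. $\alpha_{i;q}=\sum_{j=1}^N p_{i,j}\,\mathbb E B_{i,j;q}(n)$ and $\tilde\alpha_{i;q}=\sum_{j=1}^N\tilde p_{i,j}\,\mathbb E\widetilde B_{i,j;q}(n)$. Since the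 arrival process is stationary in time, with $\lambda_q$ the mean number of arrivals at station $q$ per unit of time, these are of the form $\alpha_{i;q}=\lambda_q\tau_i$ and $\tilde\alpha_{i;q}=\lambda_q\tilde\tau_i$. Here $\tau_i$ (resp. $\tilde\tau_i$) is the mean time between a polling instant at which the server finds station $i$ nonempty (resp. empty) and the next polling instant. $T_{j,j}$ is the time (in the stationary regime) between two consecutive visits of the server to station $j$; the mean number of arrivals to queue $j$ between two such visits equals $\lambda_j\mathbb E T_{j,j}$. *)

theory Defs
  imports "HOL-Probability.Probability"
begin

section \<open>Markov chains given by a transition kernel\<close>

definition step_distr :: "('a \<Rightarrow> 'a pmf) \<Rightarrow> nat \<Rightarrow> 'a \<Rightarrow> 'a pmf" where
  "step_distr K n s = ((\<lambda>p. bind_pmf p K) ^^ n) (return_pmf s)"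

definition irreducible_chain :: "('a \<Rightarrow> 'a pmf) \<Rightarrow> bool" where
  "irreducible_chain K \<longleftrightarrow> (\<forall>s t. \<exists>n. pmf (step_distr K n s) t > 0)"

text \<open>\<open>first_passage K t n s\<close> is the probability that the chain started in \<open>s\<close> enters \<open>t\<close>
  at time \<open>n + 1\<close> for the first time, time \<open>0\<close> not being counted.\<close>

primrec first_passage :: "('a \<Rightarrow> 'a pmf) \<Rightarrow> 'a \<Rightarrow> nat \<Rightarrow> 'a \<Rightarrow> real" where
  "first_passage K t 0 s = pmf (K s) t"
| "first_passage K t (Suc n) s =
     measure_pmf.expectation (K s) (\<lambda>u. if u = t then 0 else first_passage K t n u)"

definition positive_recurrent :: "('a \<Rightarrow> 'a pmf) \<Rightarrow> 'a \<Rightarrow> bool" where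
  "positive_recurrent K s \<longleftrightarrow>
     (\<lambda>n. first_passage K s n s) sums 1 \<and>
     summable (\<lambda>n. real (Suc n) * first_passage K s n s)"

text \<open>Aperiodicity is not demanded, so that chains that are ergodic in the narrower sense
  (irreducible, aperiodic and positive recurrent) are covered as well.\<close>

definition ergodic_chain :: "('a \<Rightarrow> 'a pmf) \<Rightarrow> bool" where
  "ergodic_chain K \<longleftrightarrow> irreducible_chain K \<and> (\<forall>s. positive_recurrent K s)"

definition stationary_distr :: "('a \<Rightarrow> 'a pmf) \<Rightarrow> 'a pmf \<Rightarrow> bool" where
  "stationary_distr K \<pi> \<longleftrightarrow> bind_pmf \<pi> K = \<pi>"


section \<open>The polling model\<close>

text \<open>The stations are the elements of a finite type \<open>'s\<close>. The pmf \<open>b i j\<close> is the common law of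
  the i.i.d. vectors \<open>B\<^sub>i\<^sub>,\<^sub>j(n)\<close>, and \<open>bt i j\<close> that of the vectors written with a tilde; a law on
  \<open>nat ^ 's\<close> leaves the joint distribution of the components arbitrary. The suffix \<open>t\<close>
  stands for the tilde throughout.\<close>

type_synonym 's polling_state = "'s \<times> (nat ^ 's)"

definition stochastic_matrix :: "real ^ 's ^ 's \<Rightarrow> bool" where
  "stochastic_matrix P \<longleftrightarrow> (\<forall>i j. 0 \<le> P $ i $ j) \<and> (\<forall>i. (\<Sum>j\<in>UNIV. P $ i $ j) = 1)"

definition polling_model ::
  "real ^ 's ^ 's \<Rightarrow> real ^ 's ^ 's \<Rightarrow>
   ('s \<Rightarrow> 's \<Rightarrow> (nat ^ 's) pmf) \<Rightarrow> ('s \<Rightarrow> 's \<Rightarrow> (nat ^ 's) pmf) \<Rightarrow> bool" where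
  "polling_model P Pt b bt \<longleftrightarrow>
     stochastic_matrix P \<and> stochastic_matrix Pt \<and>
     (\<forall>i j q. integrable (measure_pmf (b i j)) (\<lambda>v. real (v $ q)) \<and>
              integrable (measure_pmf (bt i j)) (\<lambda>v. real (v $ q)))"

text \<open>The law of the next station; meaningful for a stochastic matrix only.\<close>

definition routing :: "real ^ 's ^ 's \<Rightarrow> 's \<Rightarrow> 's pmf" where
  "routing P i = embed_pmf (\<lambda>j. P $ i $ j)"

text \<open>In the first branch the subtraction on \<open>nat ^ 's\<close> does not truncate, as \<open>x $ i > 0\<close>.\<close>

definition polling_kernel ::
  "real ^ 's ^ 's \<Rightarrow> real ^ 's ^ 's \<Rightarrow>
   ('s \<Rightarrow> 's \<Rightarrow> (nat ^ 's) pmf) \<Rightarrow> ('s \<Rightarrow> 's \<Rightarrow> (nat ^ 's) pmf) \<Rightarrow>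
   's polling_state \<Rightarrow> 's polling_state pmf" where
  "polling_kernel P Pt b bt = (\<lambda>(i, x).
     if x $ i > 0
     then bind_pmf (routing P i) (\<lambda>j. map_pmf (\<lambda>v. (j, x - axis i 1 + v)) (b i j))
     else bind_pmf (routing Pt i) (\<lambda>j. map_pmf (\<lambda>v. (j, x + v)) (bt i j)))"

definition station_prob :: "('s polling_state) pmf \<Rightarrow> real ^ 's" where
  "station_prob \<pi> = (\<chi> i. measure_pmf.prob \<pi> {(s, x). s = i})"

definition station_empty_prob :: "('s polling_state) pmf \<Rightarrow> real ^ 's" where
  "station_empty_prob \<pi> = (\<chi> i. measure_pmf.prob \<pi> {(s, x). s = i \<and> x $ i = 0})"

definition mean_arrivals ::
  "real ^ 's ^ 's \<Rightarrow> ('s \<Rightarrow> 's \<Rightarrow> (nat ^ 's) pmf) \<Rightarrow> real ^ 's ^ 's" where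
  "mean_arrivals P b =
     (\<chi> i q. \<Sum>j\<in>UNIV. P $ i $ j * measure_pmf.expectation (b i j) (\<lambda>v. real (v $ q)))"

definition rho_hat :: "real ^ 's \<Rightarrow> real ^ 's \<Rightarrow> real ^ 's \<Rightarrow> real" where
  "rho_hat lam tau taut = (\<Sum>i\<in>UNIV. lam $ i * (tau $ i - taut $ i))"

definition tau_bar :: "real ^ 's \<Rightarrow> real ^ 's \<Rightarrow> real ^ 's \<Rightarrow> real ^ 's \<Rightarrow> real" where
  "tau_bar lam tau taut f = 1 / (1 - rho_hat lam tau taut) * (\<Sum>j\<in>UNIV. f $ j * taut $ j)"


section \<open>The stationary process in continuous time\<close>

text \<open>The process \<open>(S n, X n)\<close> is the stationary chain with kernel \<open>K\<close> and initial law \<open>\<pi>\<close>,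
  \<open>\<F> n\<close> is the past up to the polling instant \<open>n\<close>, and \<open>D n\<close> is the time between the polling
  instants \<open>n\<close> and \<open>n + 1\<close>. Given the past, the mean of \<open>D n\<close> is the entry of \<open>tau\<close> or \<open>taut\<close>
  for the current station, according to whether its queue is nonempty or empty. Nothing else
  is required of \<open>D\<close>; in particular \<open>D n\<close> may depend on the next state.\<close>

locale stationary_polling_process = prob_space M
  for M :: "'w measure" +
  fixes K :: "'s::finite polling_state \<Rightarrow> 's polling_state pmf"
    and \<pi> :: "'s polling_state pmf"
    and tau taut :: "real ^ 's"
    and \<F> :: "nat \<Rightarrow> 'w measure"
    and S :: "nat \<Rightarrow> 'w \<Rightarrow> 's"
    and X :: "nat \<Rightarrow> 'w \<Rightarrow> nat ^ 's"
    and D :: "nat \<Rightarrow> 'w \<Rightarrow> real"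
  assumes past_subalgebra: "\<And>n. subalgebra M (\<F> n)"
    and past_mono: "\<And>n. sets (\<F> n) \<subseteq> sets (\<F> (Suc n))"
    and S_adapted: "\<And>n. S n \<in> measurable (\<F> n) (count_space UNIV)"
    and X_adapted: "\<And>n. X n \<in> measurable (\<F> n) (count_space UNIV)"
    and initial_law:
      "distr M (count_space UNIV) (\<lambda>\<omega>. (S 0 \<omega>, X 0 \<omega>)) = measure_pmf \<pi>"
    and stationary: "stationary_distr K \<pi>"
    and markov:
      "\<And>n t. AE \<omega> in M.
         real_cond_exp M (\<F> n) (indicator {\<omega> \<in> space M. (S (Suc n) \<omega>, X (Suc n) \<omega>) = t}) \<omega>
           = pmf (K (S n \<omega>, X n \<omega>)) t"
    and D_nonneg: "\<And>n \<omega>. \<omega> \<in> space M \<Longrightarrow> 0 \<le> D n \<omega>"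
    and D_integrable: "\<And>n. integrable M (D n)"
    and D_mean:
      "\<And>n. AE \<omega> in M. real_cond_exp M (\<F> n) (D n) \<omega>
           = (if X n \<omega> $ S n \<omega> > 0 then tau $ S n \<omega> else taut $ S n \<omega>)"

text \<open>Time is measured from the polling instant \<open>0\<close>.\<close>

definition polling_instant :: "(nat \<Rightarrow> 'w \<Rightarrow> real) \<Rightarrow> nat \<Rightarrow> 'w \<Rightarrow> real" where
  "polling_instant D n \<omega> = (\<Sum>m<n. D m \<omega>)"

definition next_visit_time ::
  "(nat \<Rightarrow> 'w \<Rightarrow> 's) \<Rightarrow> (nat \<Rightarrow> 'w \<Rightarrow> real) \<Rightarrow> 's \<Rightarrow> 'w \<Rightarrow> ennreal" where
  "next_visit_time S D j \<omega> =
     (if \<exists>n>0. S n \<omega> = j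
      then ennreal (polling_instant D (LEAST n. n > 0 \<and> S n \<omega> = j) \<omega>)
      else \<infinity>)"

text \<open>The mean of \<open>T\<^sub>j\<^sub>,\<^sub>j\<close>: the stationary process is conditioned on the server being at \<open>j\<close> at
  the polling instant \<open>0\<close>, so that the next visit to \<open>j\<close> occurs after the time \<open>T\<^sub>j\<^sub>,\<^sub>j\<close>. Polling
  the same station twice in a row counts as two consecutive visits.\<close>

definition mean_return_time ::
  "'w measure \<Rightarrow> (nat \<Rightarrow> 'w \<Rightarrow> 's) \<Rightarrow> (nat \<Rightarrow> 'w \<Rightarrow> real) \<Rightarrow> 's \<Rightarrow> ennreal" where
  "mean_return_time M S D j =
     (\<integral>\<^sup>+ \<omega>. next_visit_time S D j \<omega> \<partial>uniform_measure M {\<omega> \<in> space M. S 0 \<omega> = j})"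

end

theory Submission
  imports Defs
begin

text \<open>Each of the two balance equations says that some function \<open>g\<close> of the state has mean one-step change
  zero in the stationary regime: the routing equation for station \<open>q\<close> takes for \<open>g\<close> the indicator of
  the server being at \<open>q\<close>, the flow equation takes the length of queue \<open>q\<close>. The
  conditional mean change depends on the state only through the current station and on whether its queue
  is empty, so its stationary mean is a linear combination of the \<open>F\<^sub>i\<close> and the probabilities
  of finding station \<open>i\<close> empty. Nothing is known about the stationary mean queue length, which may be
  infinite; \<open>stationary_mean_drift_zero\<close> gets around this by truncating \<open>g\<close>, using that a queue loses
  at most one customer per step.

  The equivalent form is linear algebra. As the mean numbers of arrivals factor into arrival rates and mean
  interval lengths, the flow equation says that \<open>f - ft\<close> is the multiple
  \<open>c\<close> of the vector of arrival rates, where \<open>c\<close> is the mean time between polling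
  instants computed from \<open>f\<close> and \<open>ft\<close>. Substituting this back gives a scalar linear equation for \<open>c\<close>,
  whose only solution is \<open>tau_bar\<close> if \<open>rho_hat \<noteq> 1\<close>.

  The mean return time is a form of Kac's formula with a cost per step. Let \<open>A\<close> be the set
  of states with the server at \<open>j\<close>, and start the chain from the stationary law. The expected number
  of visits to a state \<open>z\<close> during an excursion from \<open>A\<close>, on the event of starting in \<open>A\<close>, equals the
  stationary probability of \<open>z\<close> (\<open>excursion_occupation\<close>). The duration of the excursion is the sum of the
  lengths of its steps, and whether the excursion is still running at step \<open>m\<close> is known at time \<open>m\<close>, so
  each length may be replaced by its conditional mean, a function of the state. Hence the integral
  of the return time over the event of starting at \<open>j\<close> is the stationary mean length of
  a step, \<open>tau_bar\<close>, and conditioning divides it by \<open>F\<^sub>j\<close>.\<close>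

section \<open>Zero mean drift under a stationary law\<close>

text \<open>The two terms of the increment \<open>g y - g x\<close> have the same law, but they need not be integrable, so
  their means cannot be subtracted. The increment itself is integrable, because it is bounded below and has an
  integrable conditional mean. The increments of the truncations of \<open>g\<close> at level \<open>n\<close> have mean
  zero and are dominated by the increment of \<open>g\<close>, so dominated convergence applies.\<close>
lemma stationary_mean_drift_zero:
  fixes K :: "'a \<Rightarrow> 'a pmf" and g :: "'a \<Rightarrow> real"
  assumes stationary: "stationary_distr K \<pi>"
    and nonneg: "\<And>x. 0 \<le> g x"
    and lower: "\<And>x y. y \<in> set_pmf (K x) \<Longrightarrow> - c \<le> g y - g x"
    and step: "\<And>x. has_bochner_integral (measure_pmf (K x)) g (g x + drift x)"
    and drift: "integrable (measure_pmf \<pi>) drift"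
  shows "measure_pmf.expectation \<pi> drift = 0"
proof -
  (* The joint law of two consecutive states. *)
  define J where "J = bind_pmf \<pi> (\<lambda>x. map_pmf (Pair x) (K x))"
  have fst_J: "map_pmf fst J = \<pi>"
    by (simp add: J_def map_bind_pmf pmf.map_comp comp_def bind_return_pmf')
  have snd_J: "map_pmf snd J = \<pi>"
    using stationary
    by (simp add: J_def map_bind_pmf pmf.map_comp comp_def stationary_distr_def)
  let ?d = "\<lambda>(x, y). g y - g x"
  have inner: "(\<integral>\<^sup>+ y. ennreal (g y - g x + c) \<partial>K x) = ennreal (drift x + c)"
    and inner_nonneg: "0 \<le> drift x + c" for x
  proof -
    have i: "integrable (K x) g" and e: "(LINT y|K x. g y) = g x + drift x"
      using step[of x] by (auto simp: has_bochner_integral_iff)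
    have nn: "AE y in K x. 0 \<le> g y - g x + c"
      using lower[of _ x] by (auto simp: AE_measure_pmf_iff algebra_simps)
    have "(LINT y|K x. (g y - g x + c)) = drift x + c"
      using i e by simp
    then show "(\<integral>\<^sup>+ y. ennreal (g y - g x + c) \<partial>K x) = ennreal (drift x + c)"
      using nn i by (subst nn_integral_eq_integral) auto
    show "0 \<le> drift x + c"
      using integral_nonneg_AE[OF nn] i e by simp
  qed
  have mean_J: "has_bochner_integral J (\<lambda>p. ?d p + c) (LINT x|\<pi>. (drift x + c))"
  proof (rule has_bochner_integral_nn_integral)
    show "AE p in J. 0 \<le> ?d p + c"
      using lower by (auto simp: AE_measure_pmf_iff J_def) (smt (verit))
    show "0 \<le> (LINT x|\<pi>. (drift x + c))"
      by (intro integral_nonneg_AE) (simp add: inner_nonneg)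
    show "(\<integral>\<^sup>+ p. ennreal (?d p + c) \<partial>J) = ennreal (LINT x|\<pi>. (drift x + c))"
      using drift inner_nonneg
      by (simp add: J_def inner nn_integral_eq_integral)
  qed simp
  have "integrable J (\<lambda>p. (?d p + c) - c)"
    using mean_J by (intro Bochner_Integration.integrable_diff) (auto simp: has_bochner_integral_iff)
  then have int_d: "integrable J ?d"
    by simp
  let ?t = "\<lambda>n::nat. \<lambda>(x, y). min (g y) (real n) - min (g x) (real n)"
  have zero: "(LINT p|J. ?t n p) = 0" for n
  proof -
    have b: "integrable J (\<lambda>p. min (g (f p)) (real n))" for f
      using nonneg by (intro measure_pmf.integrable_const_bound[where B = n]) auto
    have "(LINT p|J. ?t n p) = (LINT p|J. min (g (snd p)) (real n)) - (LINT p|J. min (g (fst p)) (real n))"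
      unfolding case_prod_beta by (intro Bochner_Integration.integral_diff b)
    also have "\<dots> = (LINT x|map_pmf snd J. min (g x) (real n)) - (LINT x|map_pmf fst J. min (g x) (real n))"
      by simp
    finally show ?thesis
      by (simp add: fst_J snd_J)
  qed
  have "(\<lambda>n. LINT p|J. ?t n p) \<longlonglongrightarrow> (LINT p|J. ?d p)"
  proof (rule integral_dominated_convergence[where w = "\<lambda>p. \<bar>?d p\<bar>"])
    show "AE p in J. (\<lambda>n. ?t n p) \<longlonglongrightarrow> ?d p"
    proof (rule AE_I2, clarify)
      fix x y
      have "eventually (\<lambda>n. g x \<le> real n \<and> g y \<le> real n) sequentially"
        by (intro eventually_conj) real_asymp+
      then show "(\<lambda>n. min (g y) (real n) - min (g x) (real n)) \<longlonglongrightarrow> g y - g x"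
        by (intro tendsto_eventually) (auto elim!: eventually_mono)
    qed
    show "integrable J (\<lambda>p. \<bar>?d p\<bar>)"
      using int_d by (rule integrable_abs)
    show "AE p in J. norm (?t n p) \<le> \<bar>?d p\<bar>" for n
      by (auto intro!: AE_I2)
  qed auto
  then have "(LINT p|J. ?d p) = 0"
    using zero by (simp add: LIMSEQ_const_iff)
  then show ?thesis
    using mean_J int_d drift by (simp add: has_bochner_integral_iff)
qed

section \<open>Excursions of a stationary Markov chain\<close>

lemma nn_integral_count_space_at:
  fixes h :: "'a \<Rightarrow> ennreal"
  shows "(\<integral>\<^sup>+t. h t * (indicator {t} x * c) \<partial>count_space UNIV) = h x * c"
  by (subst nn_integral_count_space'[of "{x}"]) auto

text \<open>The past is an arbitrary filtration to which the chain is adapted, rather than the one generated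
  by the chain: step lengths observed along with the chain are conditioned on this larger past.\<close>
locale stationary_markov_chain = prob_space M
  for M :: "'w measure" +
  fixes K :: "'a::countable \<Rightarrow> 'a pmf"
    and \<pi> :: "'a pmf"
    and G :: "nat \<Rightarrow> 'w measure"
    and Z :: "nat \<Rightarrow> 'w \<Rightarrow> 'a"
  assumes subalgebra: "\<And>n. subalgebra M (G n)"
    and filtration: "\<And>n. sets (G n) \<subseteq> sets (G (Suc n))"
    and adapted: "\<And>n. Z n \<in> measurable (G n) (count_space UNIV)"
    and initial: "distr M (count_space UNIV) (Z 0) = measure_pmf \<pi>"
    and stationary: "stationary_distr K \<pi>"
    and markov:
      "\<And>n t. AE \<omega> in M.
         real_cond_exp M (G n) (indicator {\<omega> \<in> space M. Z (Suc n) \<omega> = t}) \<omega> = pmf (K (Z n \<omega>)) t"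
begin

definition avoiding :: "'a set \<Rightarrow> nat \<Rightarrow> nat \<Rightarrow> 'w set" where
  "avoiding A k n = {\<omega> \<in> space M. \<forall>i\<in>{k..n}. Z i \<omega> \<notin> A}"

text \<open>The event that an excursion begins in \<open>A\<close> at time \<open>0\<close> and still runs during the step from \<open>n\<close> to
  \<open>Suc n\<close>.\<close>
definition excursion :: "'a set \<Rightarrow> nat \<Rightarrow> 'w set" where
  "excursion A n = {\<omega> \<in> space M. Z 0 \<omega> \<in> A} \<inter> avoiding A 1 n"

lemma space_G [simp]: "space (G n) = space M"
  using subalgebra[of n] by (simp add: subalgebra_def)

lemma sets_G: "C \<in> sets (G n) \<Longrightarrow> C \<in> sets M"
  using subalgebra[of n] by (auto simp: subalgebra_def)

lemma sets_G_mono: "C \<in> sets (G k) \<Longrightarrow> k \<le> n \<Longrightarrow> C \<in> sets (G n)"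
  using lift_Suc_mono_le[of "\<lambda>n. sets (G n)" k n] filtration by blast

lemma event_G: "k \<le> n \<Longrightarrow> {\<omega> \<in> space M. Z k \<omega> \<in> B} \<in> sets (G n)"
  using measurable_sets[OF adapted, of B k]
  by (intro sets_G_mono[of _ k n]) (auto simp: vimage_def Int_def conj_commute)

lemma measurable_Z [measurable]: "Z n \<in> measurable M (count_space UNIV)"
  using adapted[of n] subalgebra[of n] by (metis measurable_from_subalg)

lemma avoiding_G: "avoiding A k n \<in> sets (G n)"
proof -
  have "{\<omega> \<in> space (G n). \<forall>i\<in>{k..n}. Z i \<omega> \<notin> A} \<in> sets (G n)"
    using event_G[of _ n "- A"] by (intro sets.sets_Collect_finite_All) auto
  then show ?thesis
    by (simp add: avoiding_def)
qed

lemma excursion_G: "excursion A n \<in> sets (G n)"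
  unfolding excursion_def by (intro sets.Int event_G avoiding_G) simp

lemma avoiding_sets [measurable]: "avoiding A k n \<in> sets M"
  by (rule sets_G[OF avoiding_G])

lemma excursion_sets [measurable]: "excursion A n \<in> sets M"
  by (rule sets_G[OF excursion_G])

text \<open>The Markov property for functions instead of single target states: a function on a countable type
  is a sum of point masses.\<close>
lemma one_step:
  fixes h :: "'a \<Rightarrow> ennreal"
  assumes C: "C \<in> sets (G n)"
  shows "(\<integral>\<^sup>+\<omega>\<in>C. h (Z (Suc n) \<omega>) \<partial>M) = (\<integral>\<^sup>+\<omega>\<in>C. (\<integral>\<^sup>+y. h y \<partial>K (Z n \<omega>)) \<partial>M)"
proof -
  interpret cond: finite_measure_subalgebra M "G n"
    by standard (rule subalgebra)
  have C_M [measurable]: "C \<in> sets M"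
    using C by (rule sets_G)
  have point: "(\<integral>\<^sup>+\<omega>\<in>C. indicator {t} (Z (Suc n) \<omega>) \<partial>M) = (\<integral>\<^sup>+\<omega>\<in>C. ennreal (pmf (K (Z n \<omega>)) t) \<partial>M)"
    for t
  proof -
    define E where "E = {\<omega> \<in> space M. Z (Suc n) \<omega> = t}"
    have E_M [measurable]: "E \<in> sets M"
      unfolding E_def by measurable
    have K_M [measurable]: "(\<lambda>\<omega>. pmf (K (Z n \<omega>)) t) \<in> borel_measurable M"
      by (rule measurable_compose[OF measurable_Z]) simp
    have int_E: "integrable M (indicator E :: 'w \<Rightarrow> real)"
      by (simp add: emeasure_finite less_top[symmetric])
    have "measure M (E \<inter> C) = (LINT \<omega>:C|M. indicator E \<omega>)"
      using sets.sets_into_space[OF E_M]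
      by (simp add: set_lebesgue_integral_def indicator_inter_arith[symmetric] Int_commute)
    also have "\<dots> = (LINT \<omega>:C|M. real_cond_exp M (G n) (indicator E) \<omega>)"
      by (rule cond.real_cond_exp_intA[OF int_E C])
    also have "\<dots> = (LINT \<omega>:C|M. pmf (K (Z n \<omega>)) t)"
      using markov[of n t] unfolding E_def[symmetric] set_lebesgue_integral_def
      by (intro integral_cong_AE) (auto elim!: eventually_mono)
    finally have *: "measure M (E \<inter> C) = (LINT \<omega>:C|M. pmf (K (Z n \<omega>)) t)" .
    have "(\<integral>\<^sup>+\<omega>\<in>C. indicator {t} (Z (Suc n) \<omega>) \<partial>M) = (\<integral>\<^sup>+\<omega>. indicator (E \<inter> C) \<omega> \<partial>M)"
      by (intro nn_integral_cong) (auto simp: E_def split: split_indicator)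
    also have "\<dots> = ennreal (LINT \<omega>:C|M. pmf (K (Z n \<omega>)) t)"
      by (simp add: emeasure_eq_measure *)
    also have "\<dots> = (\<integral>\<^sup>+\<omega>. ennreal (indicator C \<omega> * pmf (K (Z n \<omega>)) t) \<partial>M)"
      unfolding set_lebesgue_integral_def real_scaleR_def
      by (intro nn_integral_eq_integral[symmetric] integrable_const_bound[where B = 1])
         (auto simp: pmf_le_1 split: split_indicator)
    also have "\<dots> = (\<integral>\<^sup>+\<omega>\<in>C. ennreal (pmf (K (Z n \<omega>)) t) \<partial>M)"
      by (intro nn_integral_cong) (auto split: split_indicator)
    finally show ?thesis .
  qed
  have K_M [measurable]: "(\<lambda>\<omega>. ennreal (pmf (K (Z n \<omega>)) t)) \<in> borel_measurable M" for t
    by (rule measurable_compose[OF measurable_Z]) simp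
  have I_M [measurable]: "(\<lambda>\<omega>. indicator {t} (Z m \<omega>) :: ennreal) \<in> borel_measurable M" for t m
    by (rule measurable_compose[OF measurable_Z]) simp
  have "(\<integral>\<^sup>+\<omega>\<in>C. h (Z (Suc n) \<omega>) \<partial>M)
      = (\<integral>\<^sup>+\<omega>. (\<integral>\<^sup>+t. h t * (indicator {t} (Z (Suc n) \<omega>) * indicator C \<omega>) \<partial>count_space UNIV) \<partial>M)"
    by (simp only: nn_integral_count_space_at)
  also have "\<dots> = (\<integral>\<^sup>+t. h t * (\<integral>\<^sup>+\<omega>\<in>C. indicator {t} (Z (Suc n) \<omega>) \<partial>M) \<partial>count_space UNIV)"
    by (subst nn_integral_count_space_nn_integral) (auto simp: nn_integral_cmult)
  also have "\<dots> = (\<integral>\<^sup>+t. h t * (\<integral>\<^sup>+\<omega>\<in>C. ennreal (pmf (K (Z n \<omega>)) t) \<partial>M) \<partial>count_space UNIV)"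
    by (simp only: point)
  also have "\<dots> = (\<integral>\<^sup>+\<omega>. (\<integral>\<^sup>+t. h t * (ennreal (pmf (K (Z n \<omega>)) t) * indicator C \<omega>) \<partial>count_space UNIV) \<partial>M)"
    by (subst nn_integral_count_space_nn_integral) (auto simp: nn_integral_cmult)
  also have "\<dots> = (\<integral>\<^sup>+\<omega>\<in>C. (\<integral>\<^sup>+y. h y \<partial>K (Z n \<omega>)) \<partial>M)"
    by (intro nn_integral_cong)
       (auto simp: nn_integral_measure_pmf nn_integral_multc mult_ac split: split_indicator)
  finally show ?thesis .
qed

lemma multi_step:
  fixes h :: "'a \<Rightarrow> ennreal"
  assumes C: "C \<in> sets (G n)"
  shows "(\<integral>\<^sup>+\<omega>\<in>C. h (Z (n + k) \<omega>) \<partial>M) = (\<integral>\<^sup>+\<omega>\<in>C. (\<integral>\<^sup>+y. h y \<partial>step_distr K k (Z n \<omega>)) \<partial>M)"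
proof (induction k arbitrary: h)
  case 0
  show ?case
    by (simp add: step_distr_def)
next
  case (Suc k)
  have "(\<integral>\<^sup>+\<omega>\<in>C. h (Z (n + Suc k) \<omega>) \<partial>M) = (\<integral>\<^sup>+\<omega>\<in>C. (\<integral>\<^sup>+y. h y \<partial>K (Z (n + k) \<omega>)) \<partial>M)"
    using one_step[OF sets_G_mono[OF C, of "n + k"]] by simp
  also have "\<dots> = (\<integral>\<^sup>+\<omega>\<in>C. (\<integral>\<^sup>+x. (\<integral>\<^sup>+y. h y \<partial>K x) \<partial>step_distr K k (Z n \<omega>)) \<partial>M)"
    by (rule Suc.IH)
  also have "\<dots> = (\<integral>\<^sup>+\<omega>\<in>C. (\<integral>\<^sup>+y. h y \<partial>step_distr K (Suc k) (Z n \<omega>)) \<partial>M)"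
    by (simp add: step_distr_def)
  finally show ?case .
qed

lemma initial_mean:
  fixes h :: "'a \<Rightarrow> ennreal"
  shows "(\<integral>\<^sup>+\<omega>. h (Z 0 \<omega>) \<partial>M) = (\<integral>\<^sup>+z. h z \<partial>\<pi>)"
  by (subst initial[symmetric], subst nn_integral_distr) auto

text \<open>By stationarity the chain may be started one step later. Both sides follow the same recursion in
  \<open>n\<close>, namely one step of the kernel killed on entering \<open>A\<close>, and for \<open>n = 0\<close> they agree because the law at time
  \<open>1\<close> is again \<open>\<pi>\<close>.\<close>
lemma shift_avoiding:
  fixes h :: "'a \<Rightarrow> ennreal"
  shows "(\<integral>\<^sup>+\<omega>\<in>avoiding A 1 (Suc n). h (Z (Suc n) \<omega>) \<partial>M) = (\<integral>\<^sup>+\<omega>\<in>avoiding A 0 n. h (Z n \<omega>) \<partial>M)"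
proof (induction n arbitrary: h)
  have killed: "(\<integral>\<^sup>+\<omega>\<in>avoiding A k (Suc n). h (Z (Suc n) \<omega>) \<partial>M)
      = (\<integral>\<^sup>+\<omega>\<in>avoiding A k n. (\<integral>\<^sup>+y. h y * indicator (- A) y \<partial>K (Z n \<omega>)) \<partial>M)"
    if "k \<le> Suc n" for k n and h :: "'a \<Rightarrow> ennreal"
  proof -
    let ?h = "\<lambda>y. h y * indicator (- A) y"
    have "(\<integral>\<^sup>+\<omega>\<in>avoiding A k (Suc n). h (Z (Suc n) \<omega>) \<partial>M)
        = (\<integral>\<^sup>+\<omega>\<in>avoiding A k n. (h (Z (Suc n) \<omega>) * indicator (- A) (Z (Suc n) \<omega>)) \<partial>M)"
      using that
      by (intro nn_integral_cong) (auto simp: avoiding_def le_Suc_eq split: split_indicator)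
    also have "\<dots> = (\<integral>\<^sup>+\<omega>\<in>avoiding A k n. (\<integral>\<^sup>+y. ?h y \<partial>K (Z n \<omega>)) \<partial>M)"
      by (rule one_step[OF avoiding_G, where h = ?h])
    finally show ?thesis .
  qed
  {
    case 0
    have "(\<integral>\<^sup>+\<omega>\<in>avoiding A 1 (Suc 0). h (Z (Suc 0) \<omega>) \<partial>M)
        = (\<integral>\<^sup>+\<omega>. (\<integral>\<^sup>+y. h y * indicator (- A) y \<partial>K (Z 0 \<omega>)) \<partial>M)"
      by (subst killed) (auto intro!: nn_integral_cong simp: avoiding_def split: split_indicator)
    also have "\<dots> = (\<integral>\<^sup>+y. h y * indicator (- A) y \<partial>bind_pmf \<pi> K)"
      by (simp only: initial_mean[of "\<lambda>x. \<integral>\<^sup>+y. h y * indicator (- A) y \<partial>K x"] nn_integral_bind_pmf)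
    also have "\<dots> = (\<integral>\<^sup>+\<omega>. h (Z 0 \<omega>) * indicator (- A) (Z 0 \<omega>) \<partial>M)"
      using stationary
      by (simp only: stationary_distr_def initial_mean[of "\<lambda>y. h y * indicator (- A) y"])
    also have "\<dots> = (\<integral>\<^sup>+\<omega>\<in>avoiding A 0 0. h (Z 0 \<omega>) \<partial>M)"
      by (intro nn_integral_cong) (auto simp: avoiding_def split: split_indicator)
    finally show ?case .
  next
    case (Suc n)
    show ?case
      by (subst killed, simp, subst Suc.IH, subst killed) auto
  }
qed

text \<open>To avoid \<open>A\<close> from time \<open>1\<close> to \<open>n\<close> is either to have started an excursion from \<open>A\<close> or to avoid \<open>A\<close> from
  time \<open>0\<close> on. With \<open>shift_avoiding\<close> the term of the excursion becomes the difference of two consecutive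
  remainders.\<close>
lemma excursion_telescope:
  fixes h :: "'a \<Rightarrow> ennreal"
  shows "(\<Sum>m\<le>n. \<integral>\<^sup>+\<omega>\<in>excursion A m. h (Z m \<omega>) \<partial>M) + (\<integral>\<^sup>+\<omega>\<in>avoiding A 0 n. h (Z n \<omega>) \<partial>M)
    = (\<integral>\<^sup>+z. h z \<partial>\<pi>)"
proof (induction n)
  have split: "(\<integral>\<^sup>+\<omega>\<in>excursion A m. h (Z m \<omega>) \<partial>M) + (\<integral>\<^sup>+\<omega>\<in>avoiding A 0 m. h (Z m \<omega>) \<partial>M)
      = (\<integral>\<^sup>+\<omega>\<in>avoiding A 1 m. h (Z m \<omega>) \<partial>M)" for m
  proof -
    have h_M [measurable]: "(\<lambda>\<omega>. h (Z m \<omega>)) \<in> borel_measurable M"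
      by (rule measurable_compose[OF measurable_Z]) simp
    have "{0..m} = insert 0 {1..m}"
      by auto
    then have "avoiding A 0 m = {\<omega> \<in> space M. Z 0 \<omega> \<notin> A} \<inter> avoiding A 1 m"
      by (auto simp: avoiding_def)
    then show ?thesis
      by (subst nn_integral_add[symmetric])
         (auto intro!: nn_integral_cong simp: excursion_def avoiding_def split: split_indicator)
  qed
  case 0
  have "avoiding A 1 0 = space M"
    by (auto simp: avoiding_def)
  then show ?case
    using split[of 0] initial_mean[of h] by (simp cong: nn_integral_cong_simp)
  case (Suc n)
  have "(\<Sum>m\<le>Suc n. \<integral>\<^sup>+\<omega>\<in>excursion A m. h (Z m \<omega>) \<partial>M)
        + (\<integral>\<^sup>+\<omega>\<in>avoiding A 0 (Suc n). h (Z (Suc n) \<omega>) \<partial>M)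
      = (\<Sum>m\<le>n. \<integral>\<^sup>+\<omega>\<in>excursion A m. h (Z m \<omega>) \<partial>M)
        + (\<integral>\<^sup>+\<omega>\<in>avoiding A 1 (Suc n). h (Z (Suc n) \<omega>) \<partial>M)"
    by (simp only: sum.atMost_Suc add.assoc split)
  also have "\<dots> = (\<integral>\<^sup>+z. h z \<partial>\<pi>)"
    by (simp only: shift_avoiding Suc.IH)
  finally show ?case .
qed

text \<open>From \<open>z\<close> the chain can reach some \<open>t\<close> in \<open>A\<close>, in \<open>k\<close> steps with probability \<open>q > 0\<close>. So out of the mass at
  \<open>z\<close> that has avoided \<open>A\<close> up to time \<open>n\<close>, at least the fraction \<open>q\<close> is lost by time \<open>n + k\<close>. The total mass that
  has avoided \<open>A\<close> decreases to a limit, hence its losses over \<open>k\<close> steps vanish.\<close>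
lemma avoiding_at_point_tendsto_0:
  assumes irreducible: "irreducible_chain K" and A: "A \<noteq> {}"
  shows "(\<lambda>n. measure M (avoiding A 0 n \<inter> {\<omega> \<in> space M. Z n \<omega> \<in> {z}})) \<longlonglongrightarrow> 0"
proof -
  obtain t where t: "t \<in> A"
    using A by blast
  obtain k where k: "pmf (step_distr K k z) t > 0"
    using irreducible unfolding irreducible_chain_def by blast
  define q where "q = pmf (step_distr K k z) t"
  define a where "a n = measure M (avoiding A 0 n)" for n
  have "decseq a"
    unfolding a_def by (intro decseq_SucI finite_measure_mono) (auto simp: avoiding_def)
  then obtain L where L: "a \<longlonglongrightarrow> L"
    using decseq_convergent[of a 0] by (auto simp: a_def)
  have bound: "measure M (avoiding A 0 n \<inter> {\<omega> \<in> space M. Z n \<omega> \<in> {z}}) \<le> (a n - a (n + k)) / q" for n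
  proof -
    define C where "C = avoiding A 0 n \<inter> {\<omega> \<in> space M. Z n \<omega> \<in> {z}}"
    have C_G: "C \<in> sets (G n)"
      unfolding C_def by (intro sets.Int avoiding_G event_G) simp
    then have C_M [measurable]: "C \<in> sets M"
      by (rule sets_G)
    define E where "E = C \<inter> {\<omega> \<in> space M. Z (n + k) \<omega> = t}"
    have E_M [measurable]: "E \<in> sets M"
      unfolding E_def by measurable
    have "emeasure M E = (\<integral>\<^sup>+\<omega>\<in>C. indicator {t} (Z (n + k) \<omega>) \<partial>M)"
      by (subst nn_integral_indicator[symmetric, OF E_M], intro nn_integral_cong)
         (auto simp: E_def split: split_indicator)
    also have "\<dots> = (\<integral>\<^sup>+\<omega>\<in>C. (\<integral>\<^sup>+y. indicator {t} y \<partial>step_distr K k (Z n \<omega>)) \<partial>M)"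
      by (rule multi_step[OF C_G])
    also have "\<dots> = (\<integral>\<^sup>+\<omega>. ennreal q * indicator C \<omega> \<partial>M)"
      by (intro nn_integral_cong) (auto simp: C_def q_def emeasure_pmf_single split: split_indicator)
    also have "\<dots> = ennreal (q * measure M C)"
      by (simp add: nn_integral_cmult emeasure_eq_measure ennreal_mult q_def)
    finally have "measure M E = q * measure M C"
      by (simp add: emeasure_eq_measure q_def)
    moreover have "measure M E \<le> measure M (avoiding A 0 n - avoiding A 0 (n + k))"
      using t by (intro finite_measure_mono) (auto simp: E_def C_def avoiding_def)
    moreover have "\<dots> = a n - a (n + k)"
      unfolding a_def by (intro finite_measure_Diff) (auto simp: avoiding_def)
    ultimately show ?thesis
      using k unfolding C_def[symmetric] q_def[symmetric]
      by (simp add: pos_le_divide_eq mult.commute)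
  qed
  have upper: "(\<lambda>n. (a n - a (n + k)) / q) \<longlonglongrightarrow> 0"
    using tendsto_divide[OF tendsto_diff[OF L LIMSEQ_ignore_initial_segment[OF L]] tendsto_const[of q]] k
    by (simp add: q_def)
  show ?thesis
    by (rule tendsto_sandwich[OF always_eventually always_eventually tendsto_const upper])
       (blast intro: bound measure_nonneg)+
qed

text \<open>For the indicator of a single state this is the limit of \<open>excursion_telescope\<close>. The case of general
  \<open>h\<close> follows by summing over the states. Letting \<open>n\<close> tend to infinity for an unbounded \<open>h\<close> at once would need
  an argument that the remainder vanishes.\<close>
theorem excursion_occupation:
  fixes h :: "'a \<Rightarrow> ennreal"
  assumes irreducible: "irreducible_chain K" and A: "A \<noteq> {}"
  shows "(\<Sum>m. \<integral>\<^sup>+\<omega>\<in>excursion A m. h (Z m \<omega>) \<partial>M) = (\<integral>\<^sup>+z. h z \<partial>\<pi>)"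
proof -
  have I_M [measurable]: "(\<lambda>\<omega>. indicator {t} (Z m \<omega>) :: ennreal) \<in> borel_measurable M" for t m
    by (rule measurable_compose[OF measurable_Z]) simp
  have point: "(\<Sum>m. \<integral>\<^sup>+\<omega>\<in>excursion A m. indicator {z} (Z m \<omega>) \<partial>M) = ennreal (pmf \<pi> z)" for z
  proof -
    let ?s = "\<lambda>m. \<integral>\<^sup>+\<omega>\<in>excursion A m. indicator {z} (Z m \<omega>) \<partial>M"
    let ?v = "\<lambda>n. avoiding A 0 n \<inter> {\<omega> \<in> space M. Z n \<omega> \<in> {z}}"
    have rest: "(\<integral>\<^sup>+\<omega>\<in>avoiding A 0 n. indicator {z} (Z n \<omega>) \<partial>M) = ennreal (measure M (?v n))" for n
    proof -
      have [measurable]: "?v n \<in> sets M"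
        by measurable
      show ?thesis
        by (subst emeasure_eq_measure[symmetric], subst nn_integral_indicator[symmetric], simp,
            intro nn_integral_cong) (auto split: split_indicator)
    qed
    have "(\<lambda>n. (\<Sum>m\<le>n. ?s m) + ennreal (measure M (?v n))) \<longlonglongrightarrow> (\<Sum>m. ?s m) + ennreal 0"
      by (intro tendsto_add summable_LIMSEQ' tendsto_ennrealI
                avoiding_at_point_tendsto_0[OF irreducible A]) simp
    then show ?thesis
      using excursion_telescope[where A = A and h = "indicator {z}"]
      by (simp add: rest emeasure_pmf_single LIMSEQ_const_iff)
  qed
  have mean: "(\<integral>\<^sup>+\<omega>\<in>excursion A m. h (Z m \<omega>) \<partial>M)
      = (\<integral>\<^sup>+z. h z * (\<integral>\<^sup>+\<omega>\<in>excursion A m. indicator {z} (Z m \<omega>) \<partial>M) \<partial>count_space UNIV)" for m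
  proof -
    have "(\<integral>\<^sup>+\<omega>\<in>excursion A m. h (Z m \<omega>) \<partial>M)
        = (\<integral>\<^sup>+\<omega>. (\<integral>\<^sup>+z. h z * (indicator {z} (Z m \<omega>) * indicator (excursion A m) \<omega>) \<partial>count_space UNIV) \<partial>M)"
      by (simp only: nn_integral_count_space_at)
    also have "\<dots> = (\<integral>\<^sup>+z. h z * (\<integral>\<^sup>+\<omega>\<in>excursion A m. indicator {z} (Z m \<omega>) \<partial>M) \<partial>count_space UNIV)"
      by (subst nn_integral_count_space_nn_integral) (auto simp: nn_integral_cmult)
    finally show ?thesis .
  qed
  have "(\<Sum>m. \<integral>\<^sup>+\<omega>\<in>excursion A m. h (Z m \<omega>) \<partial>M)
      = (\<integral>\<^sup>+z. (\<Sum>m. h z * (\<integral>\<^sup>+\<omega>\<in>excursion A m. indicator {z} (Z m \<omega>) \<partial>M)) \<partial>count_space UNIV)"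
    by (simp only: mean, subst nn_integral_suminf) auto
  also have "\<dots> = (\<integral>\<^sup>+z. h z \<partial>\<pi>)"
    by (simp add: point nn_integral_measure_pmf mult.commute)
  finally show ?thesis .
qed

text \<open>The case \<open>h = 1\<close> of \<open>excursion_occupation\<close> makes the probabilities that the excursion still runs at time
  \<open>m\<close> summable, and by Borel-Cantelli almost every excursion ends.\<close>
lemma return_AE:
  assumes irreducible: "irreducible_chain K" and A: "A \<noteq> {}"
  shows "AE \<omega> in M. Z 0 \<omega> \<in> A \<longrightarrow> (\<exists>n>0. Z n \<omega> \<in> A)"
proof -
  have total: "(\<Sum>m. emeasure M (excursion A m)) = 1"
    using excursion_occupation[OF irreducible A, where h = "\<lambda>_. 1"]
    by simp
  then have "summable (\<lambda>m. measure M (excursion A m))"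
    by (intro summable_suminf_not_top) (simp_all add: emeasure_eq_measure)
  then have "AE \<omega> in M. eventually (\<lambda>n. \<omega> \<in> space M - excursion A n) sequentially"
    by (intro borel_cantelli_AE1) (simp_all add: emeasure_eq_measure)
  then show ?thesis
  proof eventually_elim
    case (elim \<omega>)
    then obtain n where "\<omega> \<in> space M" "\<omega> \<notin> excursion A n"
      by (auto simp: eventually_sequentially)
    then have "Z 0 \<omega> \<in> A \<longrightarrow> (\<exists>i\<in>{1..n}. Z i \<omega> \<in> A)"
      by (auto simp: excursion_def avoiding_def)
    then show ?case
      by (metis atLeastAtMost_iff less_le_trans zero_less_one)
  qed
qed

end

section \<open>The balance equations of the polling model\<close>

lemma pmf_routing: "stochastic_matrix P \<Longrightarrow> pmf (routing P i) j = P $ i $ j"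
  unfolding routing_def
  by (rule pmf_embed_pmf)
     (auto simp: stochastic_matrix_def nn_integral_count_space_finite sum_nonneg)

lemma has_bochner_integral_routing:
  fixes g :: "'a \<Rightarrow> real" and P :: "real ^ 's ^ 's"
  assumes P: "stochastic_matrix P" and nonneg: "\<And>y. 0 \<le> g y"
    and integrable: "\<And>j. integrable (measure_pmf (b j)) (\<lambda>v. g (f j v))"
  shows "has_bochner_integral (measure_pmf (bind_pmf (routing P i) (\<lambda>j. map_pmf (f j) (b j)))) g
           (\<Sum>j\<in>UNIV. P $ i $ j * measure_pmf.expectation (b j) (\<lambda>v. g (f j v)))"
proof (rule has_bochner_integral_nn_integral)
  let ?e = "\<lambda>j. measure_pmf.expectation (b j) (\<lambda>v. g (f j v))"
  have P_nonneg: "0 \<le> P $ i $ j" for j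
    using P by (simp add: stochastic_matrix_def)
  have e_nonneg: "0 \<le> ?e j" for j
    by (simp add: nonneg)
  show "0 \<le> (\<Sum>j\<in>UNIV. P $ i $ j * ?e j)"
    by (intro sum_nonneg mult_nonneg_nonneg P_nonneg e_nonneg)
  have "(\<integral>\<^sup>+y. ennreal (g y) \<partial>bind_pmf (routing P i) (\<lambda>j. map_pmf (f j) (b j)))
      = (\<integral>\<^sup>+j. ennreal (?e j) \<partial>routing P i)"
    using integrable nonneg by (simp add: nn_integral_eq_integral)
  also have "\<dots> = (\<Sum>j\<in>UNIV. ennreal (?e j) * ennreal (P $ i $ j))"
    by (subst nn_integral_measure_pmf_support[of UNIV]) (auto simp: pmf_routing[OF P])
  also have "\<dots> = ennreal (\<Sum>j\<in>UNIV. P $ i $ j * ?e j)"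
    using P_nonneg e_nonneg by (simp add: ennreal_mult[symmetric] mult.commute)
  finally show "(\<integral>\<^sup>+y. ennreal (g y) \<partial>bind_pmf (routing P i) (\<lambda>j. map_pmf (f j) (b j)))
      = ennreal (\<Sum>j\<in>UNIV. P $ i $ j * ?e j)" .
qed (simp_all add: nonneg)

lemma expectation_busy_or_empty:
  fixes u w :: "'s::finite \<Rightarrow> real" and \<pi> :: "'s polling_state pmf"
  shows "has_bochner_integral (measure_pmf \<pi>) (\<lambda>(i, x). if x $ i > 0 then u i else w i)
    (\<Sum>i\<in>UNIV. (station_prob \<pi> $ i - station_empty_prob \<pi> $ i) * u i + station_empty_prob \<pi> $ i * w i)"
proof -
  let ?F = "\<lambda>i::'s. {(s, x :: nat ^ 's). s = i}"
  let ?E = "\<lambda>i::'s. {(s, x :: nat ^ 's). s = i \<and> x $ i = 0}"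
  have "(\<lambda>(i, x). if x $ i > 0 then u i else w i)
      = (\<lambda>z. \<Sum>i\<in>UNIV. (indicator (?F i) z - indicator (?E i) z) * u i + indicator (?E i) z * w i)"
  proof (rule ext, clarify)
    fix s :: 's and x :: "nat ^ 's"
    have "(\<Sum>i\<in>UNIV. (indicator (?F i) (s, x) - indicator (?E i) (s, x)) * u i + indicator (?E i) (s, x) * w i)
        = (\<Sum>i\<in>UNIV. if i = s then (if x $ s > 0 then u s else w s) else 0)"
      by (intro sum.cong) (auto simp: indicator_def)
    then show "(if x $ s > 0 then u s else w s)
        = (\<Sum>i\<in>UNIV. (indicator (?F i) (s, x) - indicator (?E i) (s, x)) * u i + indicator (?E i) (s, x) * w i)"
      by simp
  qed
  moreover have "has_bochner_integral (measure_pmf \<pi>) (indicator B) (measure_pmf.prob \<pi> B)" for B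
    by (rule has_bochner_integral_real_indicator) (auto simp: measure_pmf.emeasure_finite less_top[symmetric])
  ultimately show ?thesis
    unfolding station_prob_def station_empty_prob_def
    by (auto intro!: has_bochner_integral_sum has_bochner_integral_add has_bochner_integral_diff
        has_bochner_integral_mult_left)
qed

lemma station_prob_sum: "station_prob \<pi> \<bullet> (\<chi> i. 1) = 1"
proof -
  have "has_bochner_integral (measure_pmf \<pi>) (\<lambda>_. 1) (\<Sum>i\<in>UNIV. station_prob \<pi> $ i)"
    using expectation_busy_or_empty[of \<pi> "\<lambda>_. 1" "\<lambda>_. 1"] by (simp add: case_prod_unfold)
  then show ?thesis
    by (simp add: has_bochner_integral_iff inner_vec_def)
qed

text \<open>Stationarity carries over from one step to \<open>n\<close> steps. So \<open>\<pi>\<close> charges every state that can be reached from a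
  state in its support, in particular the one with the server at \<open>j\<close> and all queues empty.\<close>
lemma station_prob_pos:
  assumes irreducible: "irreducible_chain K" and stationary: "stationary_distr K \<pi>"
  shows "0 < station_prob \<pi> $ j"
proof -
  obtain s where s: "s \<in> set_pmf \<pi>"
    using set_pmf_not_empty[of \<pi>] by blast
  obtain n where n: "pmf (step_distr K n s) (j, 0) > 0"
    using irreducible unfolding irreducible_chain_def by blast
  have iterate: "bind_pmf \<pi> (step_distr K n) = \<pi>"
  proof (induction n)
    case 0
    show ?case
      by (simp add: step_distr_def bind_return_pmf')
  next
    case (Suc n)
    have "bind_pmf \<pi> (step_distr K (Suc n)) = bind_pmf (bind_pmf \<pi> (step_distr K n)) K"
      by (simp add: step_distr_def[abs_def] bind_assoc_pmf)
    then show ?case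
      using Suc stationary by (simp add: stationary_distr_def)
  qed
  have "(j, 0) \<in> set_pmf (bind_pmf \<pi> (step_distr K n))"
    using n by (auto simp: set_pmf_iff intro!: bexI[OF _ s])
  then show ?thesis
    by (auto simp: iterate station_prob_def intro!: measure_pmf_posI)
qed

text \<open>Here \<open>m i j\<close> and \<open>mt i j\<close> are the mean changes of \<open>g\<close> in a step from \<open>i\<close> to \<open>j\<close> with queue \<open>i\<close> nonempty or empty.
  That they are the same for all \<open>x\<close> makes the drift a function of the station and of the
  emptiness of its queue only.\<close>
lemma polling_drift_zero:
  fixes P Pt :: "real ^ 's ^ 's" and \<pi> :: "'s polling_state pmf"
  assumes model: "polling_model P Pt b bt"
    and stationary: "stationary_distr (polling_kernel P Pt b bt) \<pi>"
    and nonneg: "\<And>z. 0 \<le> g z"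
    and lower: "\<And>y z. y \<in> set_pmf (polling_kernel P Pt b bt z) \<Longrightarrow> - c \<le> g y - g z"
    and busy: "\<And>i x j. x $ i > 0 \<Longrightarrow>
      has_bochner_integral (measure_pmf (b i j)) (\<lambda>v. g (j, x - axis i 1 + v)) (g (i, x) + m i j)"
    and empty: "\<And>i x j. x $ i = 0 \<Longrightarrow>
      has_bochner_integral (measure_pmf (bt i j)) (\<lambda>v. g (j, x + v)) (g (i, x) + mt i j)"
  shows "(\<Sum>i\<in>UNIV. (station_prob \<pi> $ i - station_empty_prob \<pi> $ i) * (\<Sum>j\<in>UNIV. P $ i $ j * m i j)
            + station_empty_prob \<pi> $ i * (\<Sum>j\<in>UNIV. Pt $ i $ j * mt i j)) = 0"
proof -
  define drift where "drift = (\<lambda>(i :: 's, x :: nat ^ 's). if x $ i > 0 then \<Sum>j\<in>UNIV. P $ i $ j * m i j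
                                       else \<Sum>j\<in>UNIV. Pt $ i $ j * mt i j)"
  have P: "stochastic_matrix P" and Pt: "stochastic_matrix Pt"
    using model by (auto simp: polling_model_def)
  have mass: "(\<Sum>j\<in>UNIV. Q $ i $ j * (r + n j)) = r + (\<Sum>j\<in>UNIV. Q $ i $ j * n j)"
    if "stochastic_matrix Q" for Q :: "real ^ 's ^ 's" and i r n
    using that
    by (simp add: stochastic_matrix_def distrib_left sum.distrib sum_distrib_right[symmetric])
  note mean = expectation_busy_or_empty[of \<pi> "\<lambda>i. \<Sum>j\<in>UNIV. P $ i $ j * m i j"
      "\<lambda>i. \<Sum>j\<in>UNIV. Pt $ i $ j * mt i j", folded drift_def]
  have "measure_pmf.expectation \<pi> drift = 0"
  proof (rule stationary_mean_drift_zero[OF stationary nonneg lower])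
    show "has_bochner_integral (measure_pmf (polling_kernel P Pt b bt z)) g (g z + drift z)" for z
    proof (cases z)
      case (Pair i x)
      show ?thesis
      proof (cases "x $ i > 0")
        case True
        note e = busy[OF True]
        show ?thesis
          using has_bochner_integral_routing[OF P nonneg, where b = "b i" and f = "\<lambda>j v. (j, x - axis i 1 + v)" and i = i] e True Pair
          by (simp add: has_bochner_integral_iff polling_kernel_def drift_def mass[OF P])
      next
        case False
        then have "x $ i = 0"
          by simp
        note e = empty[OF this]
        show ?thesis
          using has_bochner_integral_routing[OF Pt nonneg, where b = "bt i" and f = "\<lambda>j v. (j, x + v)" and i = i] e False Pair
          by (simp add: has_bochner_integral_iff polling_kernel_def drift_def mass[OF Pt])
      qed
    qed
    show "integrable (measure_pmf \<pi>) drift"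
      using mean by (simp add: has_bochner_integral_iff)
  qed
  then show ?thesis
    using mean by (simp add: has_bochner_integral_iff)
qed

text \<open>Zero drift of the indicator of the server being at \<open>q\<close>.\<close>
lemma station_balance:
  fixes P Pt :: "real ^ 's ^ 's" and \<pi> :: "'s polling_state pmf"
  assumes model: "polling_model P Pt b bt"
    and stationary: "stationary_distr (polling_kernel P Pt b bt) \<pi>"
  shows "station_prob \<pi> v* (mat 1 - P) = station_empty_prob \<pi> v* (Pt - P)"
proof (subst vec_eq_iff, rule allI)
  fix q :: 's
  let ?F = "station_prob \<pi>" and ?E = "station_empty_prob \<pi>"
  let ?m = "\<lambda>i j. of_bool (j = q) - of_bool (i = q) :: real"
  have stoch: "stochastic_matrix P" "stochastic_matrix Pt"
    using model by (auto simp: polling_model_def)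
  have row: "(\<Sum>j\<in>UNIV. Q $ i $ j * ?m i j) = Q $ i $ q - of_bool (i = q)"
    if "stochastic_matrix Q" for Q :: "real ^ 's ^ 's" and i
    using that
    by (simp add: stochastic_matrix_def right_diff_distrib sum_subtractf sum_distrib_right[symmetric])
  have "(\<Sum>i\<in>UNIV. (?F $ i - ?E $ i) * (\<Sum>j\<in>UNIV. P $ i $ j * ?m i j)
            + ?E $ i * (\<Sum>j\<in>UNIV. Pt $ i $ j * ?m i j)) = 0"
    by (rule polling_drift_zero[OF model stationary, where g = "\<lambda>z. of_bool (fst z = q)" and c = 1])
       (auto simp: has_bochner_integral_iff)
  then have *: "(\<Sum>i\<in>UNIV. (?F $ i - ?E $ i) * (P $ i $ q - of_bool (i = q))
            + ?E $ i * (Pt $ i $ q - of_bool (i = q))) = 0"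
    by (simp only: row[OF stoch(1)] row[OF stoch(2)])
  have "(?F v* (mat 1 - P)) $ q - (?E v* (Pt - P)) $ q =
     (\<Sum>i\<in>UNIV. ?F $ i * (mat 1 - P) $ i $ q - ?E $ i * (Pt - P) $ i $ q)"
    by (simp add: vector_matrix_mult_def sum_subtractf)
  also have "\<dots> = - (\<Sum>i\<in>UNIV. (?F $ i - ?E $ i) * (P $ i $ q - of_bool (i = q))
            + ?E $ i * (Pt $ i $ q - of_bool (i = q)))"
    unfolding sum_negf[symmetric] by (intro sum.cong) (auto simp: mat_def algebra_simps)
  finally show "(?F v* (mat 1 - P)) $ q = (?E v* (Pt - P)) $ q"
    using * by simp
qed

text \<open>Zero drift of the length of queue \<open>q\<close>.\<close>
lemma queue_balance:
  fixes P Pt :: "real ^ 's ^ 's" and \<pi> :: "'s polling_state pmf"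
  assumes model: "polling_model P Pt b bt"
    and stationary: "stationary_distr (polling_kernel P Pt b bt) \<pi>"
  shows "station_prob \<pi> v* (mat 1 - mean_arrivals P b)
    = station_empty_prob \<pi> v* (mat 1 - mean_arrivals P b + mean_arrivals Pt bt)"
proof (subst vec_eq_iff, rule allI)
  fix q :: 's
  let ?F = "station_prob \<pi>" and ?E = "station_empty_prob \<pi>"
  let ?A = "mean_arrivals P b" and ?At = "mean_arrivals Pt bt"
  let ?m = "\<lambda>i j. measure_pmf.expectation (b i j) (\<lambda>v. real (v $ q)) - of_bool (i = q)"
  let ?mt = "\<lambda>i j. measure_pmf.expectation (bt i j) (\<lambda>v. real (v $ q))"
  have stoch: "stochastic_matrix P"
    and int: "\<And>i j. integrable (measure_pmf (b i j)) (\<lambda>v. real (v $ q))"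
      "\<And>i j. integrable (measure_pmf (bt i j)) (\<lambda>v. real (v $ q))"
    using model by (auto simp: polling_model_def)
  have row: "(\<Sum>j\<in>UNIV. P $ i $ j * ?m i j) = ?A $ i $ q - of_bool (i = q)" for i
    using stoch
    by (simp add: stochastic_matrix_def mean_arrivals_def right_diff_distrib sum_subtractf
        sum_distrib_right[symmetric])
  (* The subtraction of natural numbers is exact here, because queue i is nonempty. *)
  have departure: "real ((x - axis i 1 + v) $ q) = real (x $ q) - of_bool (i = q) + real (v $ q)"
    if "x $ i > 0" for i and x v :: "nat ^ 's"
    using that by (auto simp: axis_def of_nat_diff)
  have "(\<Sum>i\<in>UNIV. (?F $ i - ?E $ i) * (\<Sum>j\<in>UNIV. P $ i $ j * ?m i j)
            + ?E $ i * (\<Sum>j\<in>UNIV. Pt $ i $ j * ?mt i j)) = 0"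
  proof (rule polling_drift_zero[OF model stationary, where g = "\<lambda>z. real (snd z $ q)" and c = 1])
    (* At most one customer leaves per step. *)
    show "- 1 \<le> real (snd y $ q) - real (snd z $ q)"
      if "y \<in> set_pmf (polling_kernel P Pt b bt z)" for y z
    proof (cases z)
      case (Pair i x)
      show ?thesis
      proof (cases "x $ i > 0")
        case True
        then obtain j v where "y = (j, x - axis i 1 + v)"
          using \<open>y \<in> _\<close> by (auto simp: polling_kernel_def Pair)
        then show ?thesis
          using departure[OF True, of v] by (simp only: Pair fst_conv snd_conv) simp
      next
        case False
        then obtain j v where "y = (j, x + v)"
          using \<open>y \<in> _\<close> by (auto simp: polling_kernel_def Pair)
        then show ?thesis
          by (simp add: Pair)
      qed
    qed
    show "has_bochner_integral (measure_pmf (b i j)) (\<lambda>v. real (snd (j, x - axis i 1 + v) $ q))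
        (real (snd (i, x) $ q) + ?m i j)" if "x $ i > 0" for i x j
      using int by (simp only: snd_conv departure[OF that]) (simp add: has_bochner_integral_iff)
    show "has_bochner_integral (measure_pmf (bt i j)) (\<lambda>v. real (snd (j, x + v) $ q))
        (real (snd (i, x) $ q) + ?mt i j)" for i x j
      using int by (simp add: has_bochner_integral_iff)
  qed simp
  then have *: "(\<Sum>i\<in>UNIV. (?F $ i - ?E $ i) * (?A $ i $ q - of_bool (i = q)) + ?E $ i * ?At $ i $ q) = 0"
    by (simp only: row) (simp add: mean_arrivals_def)
  have "(?F v* (mat 1 - ?A)) $ q - (?E v* (mat 1 - ?A + ?At)) $ q =
     (\<Sum>i\<in>UNIV. ?F $ i * (mat 1 - ?A) $ i $ q - ?E $ i * (mat 1 - ?A + ?At) $ i $ q)"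
    by (simp add: vector_matrix_mult_def sum_subtractf)
  also have "\<dots> = - (\<Sum>i\<in>UNIV. (?F $ i - ?E $ i) * (?A $ i $ q - of_bool (i = q)) + ?E $ i * ?At $ i $ q)"
    unfolding sum_negf[symmetric] by (intro sum.cong) (auto simp: mat_def algebra_simps)
  finally show "(?F v* (mat 1 - ?A)) $ q = (?E v* (mat 1 - ?A + ?At)) $ q"
    using * by simp
qed

section \<open>Solving the balance equations\<close>

lemma tau_bar_unique:
  assumes "rho_hat lam tau taut \<noteq> 1"
  shows "c = tau_bar lam tau taut f \<longleftrightarrow> c = c * rho_hat lam tau taut + (\<Sum>j\<in>UNIV. f $ j * taut $ j)"
proof -
  have "c = tau_bar lam tau taut f \<longleftrightarrow> c * (1 - rho_hat lam tau taut) = (\<Sum>j\<in>UNIV. f $ j * taut $ j)"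
    using assms by (simp add: tau_bar_def eq_divide_eq)
  then show ?thesis
    by (auto simp: algebra_simps)
qed

text \<open>The sum on the left is the mean time between polling instants, written with the shares \<open>f - ft\<close> and \<open>ft\<close> of
  polling instants at which the station is found nonempty or empty. With \<open>f - ft = c lam\<close> it is an affine function
  of \<open>c\<close> with slope \<open>rho_hat\<close>, and \<open>tau_bar\<close> is its fixed point.\<close>
lemma mean_interval_eq_tau_bar:
  fixes f ft lam tau taut :: "real ^ 's"
  assumes rho: "rho_hat lam tau taut \<noteq> 1"
    and ft: "\<And>j. ft $ j = f $ j - lam $ j * c"
  shows "(\<Sum>i\<in>UNIV. (f $ i - ft $ i) * tau $ i + ft $ i * taut $ i) = c \<longleftrightarrow> c = tau_bar lam tau taut f"
proof -
  have "(\<Sum>i\<in>UNIV. (f $ i - ft $ i) * tau $ i + ft $ i * taut $ i)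
      = (\<Sum>i\<in>UNIV. c * (lam $ i * (tau $ i - taut $ i)) + f $ i * taut $ i)"
    by (intro sum.cong) (simp_all add: ft algebra_simps)
  also have "\<dots> = c * rho_hat lam tau taut + (\<Sum>i\<in>UNIV. f $ i * taut $ i)"
    by (simp add: rho_hat_def sum.distrib sum_distrib_left)
  finally show ?thesis
    using tau_bar_unique[OF rho, of c f] by auto
qed

text \<open>The flow equation alone is equivalent to \<open>ft = f - c lam\<close>, where \<open>c\<close> is the mean interval computed from \<open>f\<close>
  and \<open>ft\<close>, and \<open>mean_interval_eq_tau_bar\<close> identifies \<open>c\<close>. Given this relation, eliminating \<open>ft\<close> from the routing
  equation gives the equation for \<open>f\<close>.\<close>
lemma balance_equations_iff:
  fixes P Pt A At :: "real ^ 's ^ 's" and f ft lam tau taut :: "real ^ 's"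
  assumes A: "\<And>i q. A $ i $ q = lam $ q * tau $ i"
    and At: "\<And>i q. At $ i $ q = lam $ q * taut $ i"
    and rho: "rho_hat lam tau taut \<noteq> 1"
  shows "f v* (mat 1 - P) = ft v* (Pt - P) \<and> f v* (mat 1 - A) = ft v* (mat 1 - A + At) \<longleftrightarrow>
    (\<forall>j. f $ j = (\<Sum>i\<in>UNIV. Pt $ i $ j * f $ i)
            + tau_bar lam tau taut f * (\<Sum>i\<in>UNIV. lam $ i * (P $ i $ j - Pt $ i $ j))) \<and>
    (\<forall>j. ft $ j = f $ j - lam $ j * tau_bar lam tau taut f)"
proof -
  define c where "c = (\<Sum>i\<in>UNIV. (f $ i - ft $ i) * tau $ i + ft $ i * taut $ i)"
  define \<tau> where "\<tau> = tau_bar lam tau taut f"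
  have unit: "(\<Sum>i\<in>UNIV. g $ i * mat 1 $ i $ q) = g $ q" for q and g :: "real ^ 's"
    by (simp add: mat_def if_distrib[of "\<lambda>a. _ * a"] cong: if_cong)
  have "(f v* (mat 1 - A)) $ q = (ft v* (mat 1 - A + At)) $ q \<longleftrightarrow> ft $ q = f $ q - lam $ q * c" for q
  proof -
    have "(f v* (mat 1 - A)) $ q - (ft v* (mat 1 - A + At)) $ q
        = f $ q - ft $ q - (\<Sum>i\<in>UNIV. f $ i * A $ i $ q - ft $ i * A $ i $ q + ft $ i * At $ i $ q)"
      by (simp add: vector_matrix_mult_def right_diff_distrib distrib_left sum_subtractf sum.distrib unit)
    also have "(\<Sum>i\<in>UNIV. f $ i * A $ i $ q - ft $ i * A $ i $ q + ft $ i * At $ i $ q) = lam $ q * c"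
      unfolding c_def sum_distrib_left by (intro sum.cong) (simp_all add: A At algebra_simps)
    finally have diff: "(f v* (mat 1 - A)) $ q - (ft v* (mat 1 - A + At)) $ q = f $ q - ft $ q - lam $ q * c" .
    show ?thesis
      unfolding eq_iff_diff_eq_0[of "(f v* (mat 1 - A)) $ q"] diff by auto
  qed
  then have queues: "f v* (mat 1 - A) = ft v* (mat 1 - A + At) \<longleftrightarrow> (\<forall>q. ft $ q = f $ q - lam $ q * c)"
    by (simp add: vec_eq_iff)
  also have "\<dots> \<longleftrightarrow> (\<forall>q. ft $ q = f $ q - lam $ q * \<tau>)"
  proof
    assume *: "\<forall>q. ft $ q = f $ q - lam $ q * c"
    then have "c = \<tau>"
      using mean_interval_eq_tau_bar[OF rho spec[OF *]] unfolding c_def[symmetric] \<tau>_def[symmetric]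
      by simp
    with * show "\<forall>q. ft $ q = f $ q - lam $ q * \<tau>"
      by simp
  next
    assume *: "\<forall>q. ft $ q = f $ q - lam $ q * \<tau>"
    then have "c = \<tau>"
      using mean_interval_eq_tau_bar[OF rho spec[OF *]] unfolding c_def[symmetric] \<tau>_def[symmetric]
      by simp
    with * show "\<forall>q. ft $ q = f $ q - lam $ q * c"
      by simp
  qed
  finally have queues: "f v* (mat 1 - A) = ft v* (mat 1 - A + At) \<longleftrightarrow>
      (\<forall>q. ft $ q = f $ q - lam $ q * \<tau>)" .
  have "f v* (mat 1 - P) = ft v* (Pt - P) \<longleftrightarrow>
      (\<forall>j. f $ j = (\<Sum>i\<in>UNIV. Pt $ i $ j * f $ i) + \<tau> * (\<Sum>i\<in>UNIV. lam $ i * (P $ i $ j - Pt $ i $ j)))"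
    if ft: "\<forall>q. ft $ q = f $ q - lam $ q * \<tau>"
  proof -
    have "(f v* (mat 1 - P)) $ j = (ft v* (Pt - P)) $ j
        \<longleftrightarrow> f $ j = ((\<Sum>i\<in>UNIV. Pt $ i $ j * f $ i) + \<tau> * (\<Sum>i\<in>UNIV. lam $ i * (P $ i $ j - Pt $ i $ j)))"
      for j
    proof -
      have "(f v* (mat 1 - P)) $ j - (ft v* (Pt - P)) $ j
          = f $ j - (\<Sum>i\<in>UNIV. f $ i * P $ i $ j + ft $ i * (Pt $ i $ j - P $ i $ j))"
        by (simp add: vector_matrix_mult_def right_diff_distrib sum_subtractf sum.distrib unit)
      also have "(\<Sum>i\<in>UNIV. f $ i * P $ i $ j + ft $ i * (Pt $ i $ j - P $ i $ j))
          = (\<Sum>i\<in>UNIV. Pt $ i $ j * f $ i + \<tau> * (lam $ i * (P $ i $ j - Pt $ i $ j)))"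
        by (intro sum.cong refl) (simp add: ft algebra_simps)
      finally have diff: "(f v* (mat 1 - P)) $ j - (ft v* (Pt - P)) $ j
          = f $ j - ((\<Sum>i\<in>UNIV. Pt $ i $ j * f $ i) + \<tau> * (\<Sum>i\<in>UNIV. lam $ i * (P $ i $ j - Pt $ i $ j)))"
        by (simp only: sum.distrib sum_distrib_left)
      show ?thesis
        unfolding eq_iff_diff_eq_0[of "(f v* (mat 1 - P)) $ j"] diff by (rule right_minus_eq)
    qed
    then show ?thesis
      by (simp only: vec_eq_iff)
  qed
  with queues show ?thesis
    unfolding \<tau>_def by blast
qed

section \<open>The mean time between two visits\<close>

context stationary_polling_process
begin

sublocale chain: stationary_markov_chain M K \<pi> \<F> "\<lambda>n \<omega>. (S n \<omega>, X n \<omega>)"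
proof unfold_locales
  show "(\<lambda>\<omega>. (S n \<omega>, X n \<omega>)) \<in> measurable (\<F> n) (count_space UNIV)" for n
    using S_adapted[of n] X_adapted[of n] by simp
qed (fact past_subalgebra past_mono initial_law stationary markov)+

definition mean_interval :: "'s polling_state \<Rightarrow> real" where
  "mean_interval = (\<lambda>(i, x). if x $ i > 0 then tau $ i else taut $ i)"

lemma D_measurable [measurable]: "D n \<in> borel_measurable M"
  using D_integrable by blast

text \<open>This is the defining property of the conditional mean, as \<open>C\<close> is an event of the past. The
  entries of \<open>tau\<close> and \<open>taut\<close> for configurations of probability zero can be negative; \<open>ennreal\<close> sends
  them to \<open>0\<close>, which is harmless on null sets.\<close>
lemma nn_integral_D:
  assumes C: "C \<in> sets (\<F> n)"
  shows "(\<integral>\<^sup>+\<omega>\<in>C. ennreal (D n \<omega>) \<partial>M) = (\<integral>\<^sup>+\<omega>\<in>C. ennreal (mean_interval (S n \<omega>, X n \<omega>)) \<partial>M)"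
proof -
  interpret cond: finite_measure_subalgebra M "\<F> n"
    by standard (rule past_subalgebra)
  have [measurable]: "C \<in> sets M"
    using C by (rule chain.sets_G)
  let ?c = "real_cond_exp M (\<F> n) (D n)"
  have c: "integrable M ?c"
    by (rule cond.real_cond_exp_int(1)[OF D_integrable])
  have c_nonneg: "AE \<omega> in M. 0 \<le> ?c \<omega>"
    by (rule cond.real_cond_exp_pos) (auto simp: D_nonneg)
  have "(\<integral>\<^sup>+\<omega>\<in>C. ennreal (D n \<omega>) \<partial>M) = (\<integral>\<^sup>+\<omega>. ennreal (indicator C \<omega> * D n \<omega>) \<partial>M)"
    by (intro nn_integral_cong) (auto split: split_indicator)
  also have "\<dots> = ennreal (LINT \<omega>:C|M. D n \<omega>)"
    unfolding set_lebesgue_integral_def real_scaleR_def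
    using integrable_mult_indicator[of C M "D n"] D_integrable
    by (intro nn_integral_eq_integral AE_I2) (simp_all add: D_nonneg)
  also have "\<dots> = ennreal (LINT \<omega>:C|M. ?c \<omega>)"
    by (simp only: cond.real_cond_exp_intA[OF D_integrable C])
  also have "\<dots> = (\<integral>\<^sup>+\<omega>. ennreal (indicator C \<omega> * ?c \<omega>) \<partial>M)"
    unfolding set_lebesgue_integral_def real_scaleR_def using c c_nonneg
    by (intro nn_integral_eq_integral[symmetric])
       (auto elim!: eventually_mono intro: integrable_mult_indicator[of C M ?c, unfolded real_scaleR_def])
  also have "\<dots> = (\<integral>\<^sup>+\<omega>\<in>C. ennreal (mean_interval (S n \<omega>, X n \<omega>)) \<partial>M)"
    using D_mean[of n]
    by (intro nn_integral_cong_AE) (auto elim!: eventually_mono simp: mean_interval_def split: split_indicator)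
  finally show ?thesis .
qed

lemma mean_interval_nonneg: "AE z in \<pi>. 0 \<le> mean_interval z"
proof -
  interpret cond: finite_measure_subalgebra M "\<F> 0"
    by standard (rule past_subalgebra)
  have "AE \<omega> in M. 0 \<le> real_cond_exp M (\<F> 0) (D 0) \<omega>"
    by (rule cond.real_cond_exp_pos) (auto simp: D_nonneg)
  then have "AE \<omega> in M. 0 \<le> mean_interval (S 0 \<omega>, X 0 \<omega>)"
    using D_mean[of 0] by eventually_elim (auto simp: mean_interval_def)
  then have "AE z in distr M (count_space UNIV) (\<lambda>\<omega>. (S 0 \<omega>, X 0 \<omega>)). 0 \<le> mean_interval z"
    by (subst AE_distr_iff) auto
  then show ?thesis
    by (simp only: initial_law)
qed

lemma next_visit_time_excursion:
  assumes \<omega>: "\<omega> \<in> space M" "S 0 \<omega> = j"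
  shows "next_visit_time S D j \<omega> =
    (if \<exists>n>0. S n \<omega> = j
     then \<Sum>m. ennreal (D m \<omega>) * indicator (chain.excursion {z. fst z = j} m) \<omega> else \<infinity>)"
proof (cases "\<exists>n>0. S n \<omega> = j")
  case True
  define N where "N = (LEAST n. n > 0 \<and> S n \<omega> = j)"
  have N: "N > 0 \<and> S N \<omega> = j"
    unfolding N_def by (rule LeastI_ex[OF True])
  have least: "N \<le> n" if "n > 0" "S n \<omega> = j" for n
    unfolding N_def using that by (intro Least_le) simp
  have exc: "\<omega> \<in> chain.excursion {z. fst z = j} m \<longleftrightarrow> m < N" for m
  proof -
    have "\<omega> \<in> chain.excursion {z. fst z = j} m \<longleftrightarrow> (\<forall>i\<in>{1..m}. S i \<omega> \<noteq> j)"
      using \<omega> by (simp add: chain.excursion_def chain.avoiding_def)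
    also have "\<dots> \<longleftrightarrow> m < N"
    proof
      assume "\<forall>i\<in>{1..m}. S i \<omega> \<noteq> j"
      then have "N \<notin> {1..m}"
        using N by blast
      then show "m < N"
        using N by simp
    next
      assume m: "m < N"
      show "\<forall>i\<in>{1..m}. S i \<omega> \<noteq> j"
      proof (intro ballI notI)
        fix i
        assume i: "i \<in> {1..m}" "S i \<omega> = j"
        then have "N \<le> i"
          by (intro least) simp_all
        with i m show False
          by simp
      qed
    qed
    finally show ?thesis .
  qed
  have "(\<Sum>m. ennreal (D m \<omega>) * indicator (chain.excursion {z. fst z = j} m) \<omega>)
      = (\<Sum>m<N. ennreal (D m \<omega>) * indicator (chain.excursion {z. fst z = j} m) \<omega>)"
    by (intro suminf_finite) (auto simp: exc)
  also have "\<dots> = ennreal (polling_instant D N \<omega>)"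
    using \<omega> D_nonneg by (simp add: exc polling_instant_def)
  finally show ?thesis
    using True by (simp add: next_visit_time_def N_def)
next
  case False
  show ?thesis
    unfolding next_visit_time_def if_not_P[OF False] by (rule refl)
qed

text \<open>On the event that the server starts at \<open>j\<close>, the time to the next visit is the sum of the step lengths during
  the excursion. Summing their means gives the stationary mean by \<open>excursion_occupation\<close>; the excursions that never
  end, on which the return time is infinite, form a null set by \<open>return_AE\<close>.\<close>
lemma mean_return_time_eq:
  assumes irreducible: "irreducible_chain K"
  shows "mean_return_time M S D j = (\<integral>\<^sup>+z. ennreal (mean_interval z) \<partial>\<pi>) / ennreal (station_prob \<pi> $ j)"
proof -
  define A :: "'s polling_state set" where "A = {z. fst z = j}"
  define B where "B = {\<omega> \<in> space M. S 0 \<omega> = j}"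
  define total where
    "total \<omega> = (if \<exists>n>0. S n \<omega> = j
      then \<Sum>m. ennreal (D m \<omega>) * indicator (chain.excursion A m) \<omega> else \<infinity>)" for \<omega>
  have A: "A \<noteq> {}"
    by (auto simp: A_def)
  have [measurable]: "S n \<in> measurable M (count_space UNIV)" for n
    using S_adapted[of n] past_subalgebra[of n] by (metis measurable_from_subalg)
  have [measurable]: "chain.excursion A m \<in> sets M" for m
    by (rule chain.excursion_sets)
  have B [measurable]: "B \<in> sets M"
    unfolding B_def by measurable
  have total_M [measurable]: "total \<in> borel_measurable M"
    unfolding total_def by measurable
  have exc_B: "\<omega> \<in> B" if "\<omega> \<in> chain.excursion A m" for \<omega> m
    using that by (auto simp: chain.excursion_def A_def B_def)
  have "AE \<omega> in M. total \<omega> * indicator B \<omega>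
      = (\<Sum>m. ennreal (D m \<omega>) * indicator (chain.excursion A m) \<omega>)"
    using chain.return_AE[OF irreducible A]
  proof (rule AE_mp, intro AE_I2 impI)
    fix \<omega>
    assume *: "\<omega> \<in> space M" "(S 0 \<omega>, X 0 \<omega>) \<in> A \<longrightarrow> (\<exists>n>0. (S n \<omega>, X n \<omega>) \<in> A)"
    show "total \<omega> * indicator B \<omega> = (\<Sum>m. ennreal (D m \<omega>) * indicator (chain.excursion A m) \<omega>)"
    proof (cases "\<omega> \<in> B")
      case True
      then show ?thesis
        using * by (simp add: total_def A_def B_def)
    next
      case False
      then have "indicator (chain.excursion A m) \<omega> = (0 :: ennreal)" for m
        using exc_B by (auto simp: indicator_def)
      then show ?thesis
        using False by simp
    qed
  qed
  then have "(\<integral>\<^sup>+\<omega>\<in>B. total \<omega> \<partial>M)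
      = (\<integral>\<^sup>+\<omega>. (\<Sum>m. ennreal (D m \<omega>) * indicator (chain.excursion A m) \<omega>) \<partial>M)"
    by (rule nn_integral_cong_AE)
  also have "\<dots> = (\<Sum>m. \<integral>\<^sup>+\<omega>\<in>chain.excursion A m. ennreal (D m \<omega>) \<partial>M)"
    by (intro nn_integral_suminf) measurable
  also have "\<dots> = (\<Sum>m. \<integral>\<^sup>+\<omega>\<in>chain.excursion A m. ennreal (mean_interval (S m \<omega>, X m \<omega>)) \<partial>M)"
    by (simp only: nn_integral_D[OF chain.excursion_G])
  also have "\<dots> = (\<integral>\<^sup>+z. ennreal (mean_interval z) \<partial>\<pi>)"
    by (rule chain.excursion_occupation[OF irreducible A])
  finally have mean: "(\<integral>\<^sup>+\<omega>\<in>B. total \<omega> \<partial>M) = (\<integral>\<^sup>+z. ennreal (mean_interval z) \<partial>\<pi>)" .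
  have "emeasure M B = emeasure \<pi> A"
    unfolding initial_law[symmetric] B_def A_def
    by (subst emeasure_distr) (auto intro!: arg_cong[where f = "emeasure M"])
  also have "\<dots> = ennreal (station_prob \<pi> $ j)"
    by (simp add: measure_pmf.emeasure_eq_measure station_prob_def A_def case_prod_unfold)
  finally have prob_B: "emeasure M B = ennreal (station_prob \<pi> $ j)" .
  have AE_B: "AE \<omega> in uniform_measure M B. \<omega> \<in> B"
    by (rule AE_uniform_measureI) auto
  have "AE \<omega> in uniform_measure M B. next_visit_time S D j \<omega> = total \<omega>"
    using AE_B by eventually_elim (simp only: B_def next_visit_time_excursion total_def A_def mem_Collect_eq)
  then have "mean_return_time M S D j = (\<integral>\<^sup>+\<omega>. total \<omega> \<partial>uniform_measure M B)"
    unfolding mean_return_time_def B_def[symmetric] by (rule nn_integral_cong_AE)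
  also have "\<dots> = (\<integral>\<^sup>+\<omega>\<in>B. total \<omega> \<partial>M) / emeasure M B"
    by (rule nn_integral_uniform_measure) auto
  finally show ?thesis
    by (simp only: mean prob_B)
qed

lemma nn_mean_interval:
  "(\<integral>\<^sup>+z. ennreal (mean_interval z) \<partial>\<pi>) = ennreal (measure_pmf.expectation \<pi> mean_interval)"
  "0 \<le> measure_pmf.expectation \<pi> mean_interval"
  "measure_pmf.expectation \<pi> mean_interval =
     (\<Sum>i\<in>UNIV. (station_prob \<pi> $ i - station_empty_prob \<pi> $ i) * tau $ i
        + station_empty_prob \<pi> $ i * taut $ i)"
proof -
  note mean = expectation_busy_or_empty[of \<pi> "\<lambda>i. tau $ i" "\<lambda>i. taut $ i",
      folded mean_interval_def, unfolded has_bochner_integral_iff]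
  show "(\<integral>\<^sup>+z. ennreal (mean_interval z) \<partial>\<pi>) = ennreal (measure_pmf.expectation \<pi> mean_interval)"
    using mean by (intro nn_integral_eq_integral mean_interval_nonneg) simp
  show "0 \<le> measure_pmf.expectation \<pi> mean_interval"
    by (rule integral_nonneg_AE[OF mean_interval_nonneg])
  show "measure_pmf.expectation \<pi> mean_interval =
     (\<Sum>i\<in>UNIV. (station_prob \<pi> $ i - station_empty_prob \<pi> $ i) * tau $ i
        + station_empty_prob \<pi> $ i * taut $ i)"
    using mean by simp
qed

end

theorem theorem3p1:
  fixes P Pt :: "real ^ 's ^ 's"
    and b bt :: "'s \<Rightarrow> 's \<Rightarrow> (nat ^ 's) pmf"
    and \<pi> :: "'s polling_state pmf"
    and lam tau taut F Ft :: "real ^ 's"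
    and A At :: "real ^ 's ^ 's"
    and M :: "'w measure" and \<F> :: "nat \<Rightarrow> 'w measure"
    and S :: "nat \<Rightarrow> 'w \<Rightarrow> 's" and X :: "nat \<Rightarrow> 'w \<Rightarrow> nat ^ 's"
    and D :: "nat \<Rightarrow> 'w \<Rightarrow> real"
  assumes model: "polling_model P Pt b bt"
    and ergodic: "ergodic_chain (polling_kernel P Pt b bt)"
    and process: "stationary_polling_process M (polling_kernel P Pt b bt) \<pi> tau taut \<F> S X D"
    and F: "F = station_prob \<pi>"
    and Ft: "Ft = station_empty_prob \<pi>"
    and A: "A = mean_arrivals P b"
    and At: "At = mean_arrivals Pt bt"
    and lam_nonneg: "\<And>q. 0 \<le> lam $ q"
    and A_rates: "\<And>i q. A $ i $ q = lam $ q * tau $ i"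
    and At_rates: "\<And>i q. At $ i $ q = lam $ q * taut $ i"
  shows "F \<bullet> (\<chi> i. 1) = 1
    \<and> F v* (mat 1 - P) = Ft v* (Pt - P)
    \<and> F v* (mat 1 - A) = Ft v* (mat 1 - A + At)
    \<and> (rho_hat lam tau taut \<noteq> 1 \<longrightarrow>
        (\<forall>f ft :: real ^ 's.
           (f v* (mat 1 - P) = ft v* (Pt - P) \<and>
            f v* (mat 1 - A) = ft v* (mat 1 - A + At))
           \<longleftrightarrow>
           ((\<forall>j. f $ j = (\<Sum>i\<in>UNIV. Pt $ i $ j * f $ i)
                   + tau_bar lam tau taut f * (\<Sum>i\<in>UNIV. lam $ i * (P $ i $ j - Pt $ i $ j))) \<and>
            (\<forall>j. ft $ j = f $ j - lam $ j * tau_bar lam tau taut f)))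
        \<and> (\<forall>j. F $ j = (\<Sum>i\<in>UNIV. Pt $ i $ j * F $ i)
                   + tau_bar lam tau taut F * (\<Sum>i\<in>UNIV. lam $ i * (P $ i $ j - Pt $ i $ j)))
        \<and> (\<forall>j. Ft $ j = F $ j - lam $ j * tau_bar lam tau taut F)
        \<and> (\<forall>j. F $ j > 0
              \<and> enn2ereal (mean_return_time M S D j) = ereal (tau_bar lam tau taut F / F $ j)))"
proof -
  interpret stationary_polling_process M "polling_kernel P Pt b bt" \<pi> tau taut \<F> S X D
    by (rule process)
  have irreducible: "irreducible_chain (polling_kernel P Pt b bt)"
    using ergodic by (simp add: ergodic_chain_def)
  have stations: "F v* (mat 1 - P) = Ft v* (Pt - P)"
    unfolding F Ft by (rule station_balance[OF model stationary])
  have queues: "F v* (mat 1 - A) = Ft v* (mat 1 - A + At)"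
    unfolding F Ft A At by (rule queue_balance[OF model stationary])
  have total: "F \<bullet> (\<chi> i. 1) = 1"
    unfolding F by (rule station_prob_sum)
  have positive: "0 < F $ j" for j
    unfolding F by (rule station_prob_pos[OF irreducible stationary])
  show ?thesis
  proof (intro conjI total stations queues impI)
    assume rho: "rho_hat lam tau taut \<noteq> 1"
    note iff = balance_equations_iff[of A lam tau At taut, OF A_rates At_rates rho]
    show "\<forall>f ft. (f v* (mat 1 - P) = ft v* (Pt - P) \<and> f v* (mat 1 - A) = ft v* (mat 1 - A + At))
       \<longleftrightarrow> ((\<forall>j. f $ j = (\<Sum>i\<in>UNIV. Pt $ i $ j * f $ i)
                + tau_bar lam tau taut f * (\<Sum>i\<in>UNIV. lam $ i * (P $ i $ j - Pt $ i $ j))) \<and>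
            (\<forall>j. ft $ j = f $ j - lam $ j * tau_bar lam tau taut f))"
      by (intro allI iff)
    have solved: "(\<forall>j. F $ j = (\<Sum>i\<in>UNIV. Pt $ i $ j * F $ i)
                + tau_bar lam tau taut F * (\<Sum>i\<in>UNIV. lam $ i * (P $ i $ j - Pt $ i $ j))) \<and>
            (\<forall>j. Ft $ j = F $ j - lam $ j * tau_bar lam tau taut F)"
      using stations queues by (intro iffD1[OF iff] conjI)
    then show "\<forall>j. F $ j = (\<Sum>i\<in>UNIV. Pt $ i $ j * F $ i)
                + tau_bar lam tau taut F * (\<Sum>i\<in>UNIV. lam $ i * (P $ i $ j - Pt $ i $ j))"
      and Ft_eq: "\<forall>j. Ft $ j = F $ j - lam $ j * tau_bar lam tau taut F"
      by (rule conjunct1, rule conjunct2)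
    have mean: "measure_pmf.expectation \<pi> mean_interval = tau_bar lam tau taut F"
      using mean_interval_eq_tau_bar[OF rho, of Ft F "tau_bar lam tau taut F"] Ft_eq
      by (simp add: nn_mean_interval(3) F[symmetric] Ft[symmetric])
    show "\<forall>j. F $ j > 0 \<and> enn2ereal (mean_return_time M S D j) = ereal (tau_bar lam tau taut F / F $ j)"
    proof (intro allI conjI positive)
      fix j
      have "mean_return_time M S D j = ennreal (tau_bar lam tau taut F) / ennreal (F $ j)"
        unfolding F[symmetric] mean[symmetric] nn_mean_interval(1)[symmetric]
        by (simp only: mean_return_time_eq[OF irreducible] F)
      also have "\<dots> = ennreal (tau_bar lam tau taut F / F $ j)"
        using positive nn_mean_interval(2) by (intro divide_ennreal) (simp_all add: mean)
      finally show "enn2ereal (mean_return_time M S D j) = ereal (tau_bar lam tau taut F / F $ j)"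
        using positive[of j] nn_mean_interval(2) by (simp add: mean enn2ereal_ennreal)
    qed
  qed
qed

end
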